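(* Assume $\mathfrak{p}=\mathfrak{c}$. Then there exists $X\subseteq P(\mathbb{N})$ such that $X$ satisfies $\mathsf{S}_1(\Omega,\Gamma)$ but $X\setminus\mathrm{Fin}$ does not satisfy $\mathsf{U}_{fin}(\Gamma,\mathcal{O})$. Moreover, $X$ is a $\tau$-set and $X\setminus\mathrm{Fin}$ is not a $\tau$-set.
   Context: $P(\mathbb{N})$ is identified with the Cantor space $\{0,1\}^{\mathbb{N}}$ (product topology) via characteristic functions; $\mathrm{Fin}$ denotes the set of finite subsets of $\mathbb{N}$. $\mathfrak{p}$ is the pseudointersection number and $\mathfrak{c}=2^{\aleph_0}$. For a space $Y$: $\mathcal{O}$ is the collection of countable open covers of $Y$; an open $\omega$-cover is an open cover $\mathcal{U}$ with $Y$ not contained in any member and every finite subset of $Y$ contained in some member; an open $\tau$-cover is an open cover $\mathcal{U}$ with $Y$ not contained in any member, each point in infinitely many members, and for all $x,y\in Y$ one of $\{U:x\in U,y\notin U\}$, $\{U:y\in U,x\notin U\}$ finite; an open $\gamma$-cover is an infinite open cover with $Y$ not contained in any member and each point in all but finitely many members. $\Omega$, $\Gamma$ denote the collections of countable open $\omega$-covers and $\gamma$-covers. $\mathsf{S}_1(\mathscr{A},\mathscr{B})$: for each sequence $(\mathcal{U}_n)$ of members of $\mathscr{A}$ there exist $U_n\in\mathcal{U}_n$ with $\{U_n:n\in\mathbb{N}\}\in\mathscr{B}$. $\mathsf{U}_{fin}(\mathscr{A},\mathscr{B})$: for each sequence $(\mathcal{U}_n)$ of members of $\mathscr{A}$ none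 containing a finite subcover, there exist finite $\mathcal{F}_n\subseteq\mathcal{U}_n$ with $\{\bigcup\mathcal{F}_n:n\in\mathbb{N}\}\in\mathscr{B}$. $Y$ is a $\tau$-set if each clopen $\tau$-cover of $Y$ contains a $\gamma$-cover of $Y$. *)

theory Defs
  imports "HOL-Analysis.Analysis"
begin

unbundle cardinal_syntax
no_notation (input) Set_Algebras.elt_set_eq (infix \<open>=o\<close> 50)

definition cantor_space :: "nat set topology" where
  "cantor_space =
     pullback_topology UNIV (\<lambda>A n. n \<in> A)
       (product_topology (\<lambda>_. discrete_topology (UNIV :: bool set)) UNIV)"

definition Fin :: "nat set set" where
  "Fin = {A. finite A}"

lemma topspace_cantor_space [simp]: "topspace cantor_space = UNIV"
  by (simp add: cantor_space_def topspace_pullback_topology)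

definition strong_fip :: "nat set set \<Rightarrow> bool" where
  "strong_fip \<F> \<longleftrightarrow> (\<forall>\<G>. \<G> \<subseteq> \<F> \<and> finite \<G> \<and> \<G> \<noteq> {} \<longrightarrow> infinite (\<Inter>\<G>))"

definition pseudointersection :: "nat set set \<Rightarrow> nat set \<Rightarrow> bool" where
  "pseudointersection \<F> P \<longleftrightarrow> infinite P \<and> (\<forall>A\<in>\<F>. finite (P - A))"

definition p_family :: "nat set set \<Rightarrow> bool" where
  "p_family \<F> \<longleftrightarrow> strong_fip \<F> \<and> (\<nexists>P. pseudointersection \<F> P)"

text \<open>HOL has no type of all cardinals; as usual a cardinal is represented by a
  well-order relation, determined up to \<open>=o\<close>.\<close>

definition pseudointersection_number :: "nat set rel" where
  "pseudointersection_number =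
     (SOME r. r \<in> {|\<F>| | \<F>. p_family \<F>} \<and> (\<forall>r'\<in>{|\<F>| | \<F>. p_family \<F>}. r \<le>o r'))"

definition continuum :: "(nat \<Rightarrow> bool) rel" where
  "continuum = ctwo ^c natLeq"

lemma continuum_ordIso: "continuum =o |UNIV :: nat set set|"
proof -
  have "Func (Field natLeq) (Field ctwo) = (UNIV :: (nat \<Rightarrow> bool) set)"
    by (auto simp: Func_def ctwo_def Field_card_of Field_natLeq)
  moreover have "bij_betw Collect (UNIV :: (nat \<Rightarrow> bool) set) UNIV"
    by (rule bij_betwI[where g = "\<lambda>A n. n \<in> A"]) auto
  then have "|UNIV :: (nat \<Rightarrow> bool) set| =o |UNIV :: nat set set|"
    by (rule card_of_ordIsoI)
  ultimately show ?thesis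
    by (simp add: continuum_def cexp_def)
qed

lemma p_family_exists: "\<exists>\<F>. p_family \<F>"
proof -
  have "\<exists>M\<in>Collect strong_fip. \<forall>X\<in>Collect strong_fip. M \<subseteq> X \<longrightarrow> X = M"
  proof (rule subset_Zorn')
    fix C assume C: "subset.chain (Collect strong_fip) C"
    have "infinite (\<Inter>\<G>)" if G: "\<G> \<subseteq> \<Union>C" "finite \<G>" "\<G> \<noteq> {}" for \<G>
    proof -
      have "C \<noteq> {}" using G by auto
      then obtain X where "X \<in> C" "\<G> \<subseteq> X"
        using finite_subset_Union_chain[OF G(2,1) _ C] by metis
      moreover from this have "strong_fip X"
        using C by (auto simp: subset_chain_def)
      ultimately show ?thesis
        using G(2,3) by (simp add: strong_fip_def)
    qed
    then show "\<Union>C \<in> Collect strong_fip"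
      by (auto simp: strong_fip_def)
  qed
  then obtain M where M: "strong_fip M"
    and max: "\<And>X. strong_fip X \<Longrightarrow> M \<subseteq> X \<Longrightarrow> X = M" by auto
  have "\<not> pseudointersection M P" for P
  proof
    assume P: "pseudointersection M P"
    have mem: "Q \<in> M" if Q: "Q \<subseteq> P" "infinite Q" for Q
    proof -
      have "infinite (\<Inter>\<G>)" if "\<G> \<subseteq> insert Q M" "finite \<G>" for \<G>
      proof -
        have "finite (Q - A)" if "A \<in> \<G>" for A
        proof (cases "A = Q")
          case False
          then have "finite (P - A)"
            using that \<open>\<G> \<subseteq> insert Q M\<close> P by (auto simp: pseudointersection_def)
          then show ?thesis
            using Q(1) by (meson Diff_mono finite_subset order_refl)
        qed simp
        then have "finite (\<Union>A\<in>\<G>. Q - A)" using \<open>finite \<G>\<close> by (intro finite_UN_I)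
        moreover have "Q \<subseteq> (\<Union>A\<in>\<G>. Q - A) \<union> \<Inter>\<G>" by auto
        ultimately show ?thesis using Q(2) by (meson finite_UnI finite_subset)
      qed
      then have "strong_fip (insert Q M)" by (auto simp: strong_fip_def)
      from max[OF this] show ?thesis by auto
    qed
    from P have "infinite P" by (auto simp: pseudointersection_def)
    then obtain A B where AB: "A \<subseteq> P" "B \<subseteq> P" "infinite A" "infinite B" "A \<inter> B = {}"
      using infinite_split by metis
    then have "{A, B} \<subseteq> M" using mem by auto
    then have "infinite (\<Inter>{A, B})"
      using M unfolding strong_fip_def by (meson finite.emptyI finite.insertI insert_not_empty)
    then have "infinite (A \<inter> B)" by simp
    with AB(5) show False by simp
  qed
  then show ?thesis using M by (auto simp: p_family_def)
qed

lemma pseudointersection_number_props: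
  shows "\<exists>\<F>. p_family \<F> \<and> pseudointersection_number = |\<F>|"
    and "p_family \<F> \<Longrightarrow> pseudointersection_number \<le>o |\<F>|"
proof -
  define R where "R = {|\<F>| | \<F>. p_family \<F>}"
  have "R \<noteq> {}" "\<forall>r\<in>R. Card_order r"
    using p_family_exists by (auto simp: R_def card_of_Card_order)
  then have "\<exists>r. r \<in> R \<and> (\<forall>r'\<in>R. r \<le>o r')"
    using exists_minim_Card_order[of R] by auto
  from someI_ex[OF this]
  have *: "pseudointersection_number \<in> R" "\<forall>r'\<in>R. pseudointersection_number \<le>o r'"
    unfolding pseudointersection_number_def R_def by auto
  from *(1) show "\<exists>\<F>. p_family \<F> \<and> pseudointersection_number = |\<F>|"
    by (auto simp: R_def)
  show "pseudointersection_number \<le>o |\<F>|" if "p_family \<F>"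
    using *(2) that by (auto simp: R_def)
qed

definition open_cover :: "'a topology \<Rightarrow> 'a set set \<Rightarrow> bool" where
  "open_cover Y \<U> \<longleftrightarrow> (\<forall>U\<in>\<U>. openin Y U) \<and> \<Union>\<U> = topspace Y"

definition omega_cover :: "'a topology \<Rightarrow> 'a set set \<Rightarrow> bool" where
  "omega_cover Y \<U> \<longleftrightarrow>
     open_cover Y \<U> \<and> (\<forall>U\<in>\<U>. \<not> topspace Y \<subseteq> U) \<and>
     (\<forall>F. finite F \<and> F \<subseteq> topspace Y \<longrightarrow> (\<exists>U\<in>\<U>. F \<subseteq> U))"

definition tau_cover :: "'a topology \<Rightarrow> 'a set set \<Rightarrow> bool" where
  "tau_cover Y \<U> \<longleftrightarrow>
     open_cover Y \<U> \<and> (\<forall>U\<in>\<U>. \<not> topspace Y \<subseteq> U) \<and>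
     (\<forall>x\<in>topspace Y. infinite {U\<in>\<U>. x \<in> U}) \<and>
     (\<forall>x\<in>topspace Y. \<forall>y\<in>topspace Y.
        finite {U\<in>\<U>. x \<in> U \<and> y \<notin> U} \<or> finite {U\<in>\<U>. y \<in> U \<and> x \<notin> U})"

definition gamma_cover :: "'a topology \<Rightarrow> 'a set set \<Rightarrow> bool" where
  "gamma_cover Y \<U> \<longleftrightarrow>
     infinite \<U> \<and> open_cover Y \<U> \<and> (\<forall>U\<in>\<U>. \<not> topspace Y \<subseteq> U) \<and>
     (\<forall>x\<in>topspace Y. finite {U\<in>\<U>. x \<notin> U})"

definition O_covers :: "'a topology \<Rightarrow> 'a set set set" where
  "O_covers Y = {\<U>. countable \<U> \<and> open_cover Y \<U>}"

definition Omega_covers :: "'a topology \<Rightarrow> 'a set set set" where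
  "Omega_covers Y = {\<U>. countable \<U> \<and> omega_cover Y \<U>}"

definition Gamma_covers :: "'a topology \<Rightarrow> 'a set set set" where
  "Gamma_covers Y = {\<U>. countable \<U> \<and> gamma_cover Y \<U>}"

text \<open>The classes of covers are passed as functions of the space, so that
  \<open>S1 Omega_covers Gamma_covers Y\<close> reads: the space \<open>Y\<close> satisfies
  $\mathsf{S}_1(\Omega,\Gamma)$.\<close>

definition S1 ::
    "('a topology \<Rightarrow> 'a set set set) \<Rightarrow> ('a topology \<Rightarrow> 'a set set set) \<Rightarrow> 'a topology \<Rightarrow> bool" where
  "S1 \<A> \<B> Y \<longleftrightarrow>
     (\<forall>\<U> :: nat \<Rightarrow> 'a set set. (\<forall>n. \<U> n \<in> \<A> Y) \<longrightarrow>
        (\<exists>U. (\<forall>n. U n \<in> \<U> n) \<and> {U n | n. True} \<in> \<B> Y))"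

definition Ufin ::
    "('a topology \<Rightarrow> 'a set set set) \<Rightarrow> ('a topology \<Rightarrow> 'a set set set) \<Rightarrow> 'a topology \<Rightarrow> bool" where
  "Ufin \<A> \<B> Y \<longleftrightarrow>
     (\<forall>\<U> :: nat \<Rightarrow> 'a set set.
        (\<forall>n. \<U> n \<in> \<A> Y \<and> (\<nexists>\<F>. \<F> \<subseteq> \<U> n \<and> finite \<F> \<and> \<Union>\<F> = topspace Y)) \<longrightarrow>
        (\<exists>\<F>. (\<forall>n. \<F> n \<subseteq> \<U> n \<and> finite (\<F> n)) \<and> {\<Union>(\<F> n) | n. True} \<in> \<B> Y))"

definition tau_set :: "'a topology \<Rightarrow> bool" where
  "tau_set Y \<longleftrightarrow>
     (\<forall>\<U>. tau_cover Y \<U> \<and> (\<forall>U\<in>\<U>. closedin Y U) \<longrightarrow> (\<exists>\<V>\<subseteq>\<U>. gamma_cover Y \<V>))"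

end

theory Submission
  imports Defs
begin

text \<open>
  The set \<open>X\<close> consists of the finite sets and all finite modifications of the members of a tower
  \<open>x\<^sub>t\<close>, decreasing with respect to almost inclusion, of length \<open>\<cc>\<close>. The steps of the recursion are
  indexed by codes of all sequences of countable families of open sets. If the sequence coded by \<open>t\<close>
  consists of \<open>\<omega>\<close>-covers of the part \<open>Y\<close> of \<open>X\<close> constructed so far, then, as \<open>|Y| < \<pp>\<close>,
  a pseudointersection selects one member from each cover so that every point of \<open>Y\<close>, in particular
  every finite set, lies in almost all of them. Since the finite sets are covered, a sparse
  enough \<open>x\<^sub>t\<close> has all its almost-subsets covered as well, and these include all later members of the
  tower (Galvin and Miller).

  Each \<open>x\<^sub>t\<close> is also made sparser than a prescribed function. Without the finite sets, counting
  elements in initial segments then yields a sequence of \<open>\<gamma>\<close>-covers that refutes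
  \<open>U\<^sub>f\<^sub>i\<^sub>n(\<Gamma>, O)\<close>. The sets \<open>{x. n \<in> x}\<close> form a \<open>\<tau>\<close>-cover because the tower is a chain; a \<open>\<gamma>\<close>-subcover
  would be an infinite set almost contained in every \<open>x\<^sub>t\<close>, contradicting sparseness.
\<close>

section \<open>The Cantor space\<close>

text \<open>A basic open set of the product restricts only finitely many coordinates, all below some
  \<open>k\<close>; fixing every coordinate below \<open>k\<close> gives a smaller
  neighbourhood.\<close>

lemma openin_cantor_space_iff:
  "openin cantor_space U \<longleftrightarrow> (\<forall>y\<in>U. \<exists>k. \<forall>z. z \<inter> {..<k} = y \<inter> {..<k} \<longrightarrow> z \<in> U)"
proof
  assume "openin cantor_space U"
  then obtain V where V: "openin (product_topology (\<lambda>_. discrete_topology (UNIV :: bool set)) UNIV) V"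
    and U: "U = (\<lambda>A n. n \<in> A) -` V"
    unfolding cantor_space_def openin_pullback_topology by auto
  show "\<forall>y\<in>U. \<exists>k. \<forall>z. z \<inter> {..<k} = y \<inter> {..<k} \<longrightarrow> z \<in> U"
  proof
    fix y assume "y \<in> U"
    then have "(\<lambda>n. n \<in> y) \<in> V" using U by simp
    with V obtain W where W: "finite {i. W i \<noteq> (UNIV :: bool set)}"
      "(\<lambda>n. n \<in> y) \<in> Pi\<^sub>E UNIV W" "Pi\<^sub>E UNIV W \<subseteq> V"
      unfolding openin_product_topology_alt by fastforce
    from W(1) obtain k where k: "{i. W i \<noteq> UNIV} \<subseteq> {..<k}"
      using finite_nat_iff_bounded by blast
    have "z \<in> U" if z: "z \<inter> {..<k} = y \<inter> {..<k}" for z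
    proof -
      have "(n \<in> z) \<in> W n" for n
      proof (cases "n < k")
        case True
        then have "(n \<in> z) = (n \<in> y)" using z by auto
        then show ?thesis using W(2) by (auto simp: PiE_iff)
      next
        case False
        then have "W n = UNIV" using k by auto
        then show ?thesis by simp
      qed
      then have "(\<lambda>n. n \<in> z) \<in> Pi\<^sub>E UNIV W" by (auto simp: PiE_iff)
      then show ?thesis using W(3) U by auto
    qed
    then show "\<exists>k. \<forall>z. z \<inter> {..<k} = y \<inter> {..<k} \<longrightarrow> z \<in> U" by blast
  qed
next
  assume U: "\<forall>y\<in>U. \<exists>k. \<forall>z. z \<inter> {..<k} = y \<inter> {..<k} \<longrightarrow> z \<in> U"
  define V where "V = {p. {n. p n} \<in> U}"
  have "openin (product_topology (\<lambda>_. discrete_topology (UNIV :: bool set)) UNIV) V"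
    unfolding openin_product_topology_alt
  proof
    fix p assume "p \<in> V"
    then obtain k where k: "\<And>z. z \<inter> {..<k} = {n. p n} \<inter> {..<k} \<Longrightarrow> z \<in> U"
      using U unfolding V_def by blast
    define W where "W i = (if i < k then {p i} else UNIV)" for i
    have "finite {i. W i \<noteq> UNIV}"
      by (rule finite_subset[of _ "{..<k}"]) (auto simp: W_def split: if_splits)
    moreover have "p \<in> Pi\<^sub>E UNIV W" by (auto simp: W_def PiE_iff)
    moreover have "Pi\<^sub>E UNIV W \<subseteq> V"
    proof
      fix q assume "q \<in> Pi\<^sub>E UNIV W"
      then have "q i = p i" if "i < k" for i
        using that by (auto simp: W_def PiE_iff dest: spec[of _ i])
      then have "{n. q n} \<inter> {..<k} = {n. p n} \<inter> {..<k}" by auto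
      from k[OF this] show "q \<in> V" by (simp add: V_def)
    qed
    ultimately show "\<exists>W. finite {i \<in> UNIV. W i \<noteq> topspace (discrete_topology (UNIV :: bool set))} \<and>
        (\<forall>i\<in>UNIV. openin (discrete_topology UNIV) (W i)) \<and> p \<in> Pi\<^sub>E UNIV W \<and> Pi\<^sub>E UNIV W \<subseteq> V"
      by (intro exI[of _ W]) auto
  qed
  moreover have "U = (\<lambda>A n. n \<in> A) -` V" by (auto simp: V_def)
  ultimately show "openin cantor_space U"
    unfolding cantor_space_def openin_pullback_topology by auto
qed

text \<open>The number \<open>d\<close> codes a length and the finite set prescribed below it. Such
  codes make the base countable and let an open set be recorded as a set of numbers.\<close>

definition cylinder :: "nat \<Rightarrow> nat set set" where
  "cylinder d = {y. y \<inter> {..<fst (prod_decode d)} = set_decode (snd (prod_decode d))}"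

lemma mem_cylinder_encode [simp]:
  "z \<in> cylinder (prod_encode (k, set_encode (y \<inter> {..<k}))) \<longleftrightarrow> z \<inter> {..<k} = y \<inter> {..<k}"
  by (simp add: cylinder_def)

lemma openin_cylinder: "openin cantor_space (cylinder d)"
  unfolding openin_cantor_space_iff cylinder_def by blast

lemma openin_cantor_space_cylinder:
  assumes "openin cantor_space U" "y \<in> U"
  shows "\<exists>d. y \<in> cylinder d \<and> cylinder d \<subseteq> U"
proof -
  obtain k where "\<And>z. z \<inter> {..<k} = y \<inter> {..<k} \<Longrightarrow> z \<in> U"
    using assms unfolding openin_cantor_space_iff by blast
  then show ?thesis
    by (intro exI[of _ "prod_encode (k, set_encode (y \<inter> {..<k}))"]) (simp add: subset_iff)
qed

lemma openin_cantor_space_eq_UN_cylinder: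
  assumes "openin cantor_space U"
  shows "\<exists>D. U = (\<Union>d\<in>D. cylinder d)"
proof
  show "U = (\<Union>d\<in>{d. cylinder d \<subseteq> U}. cylinder d)"
    using openin_cantor_space_cylinder[OF assms] by blast
qed

lemma clopen_cantor_space_finite_support:
  assumes "\<And>y. P y \<longleftrightarrow> P (y \<inter> {..<k})"
  shows "openin (subtopology cantor_space Z) {y\<in>Z. P y}"
    and "closedin (subtopology cantor_space Z) {y\<in>Z. P y}"
proof -
  have op: "openin (subtopology cantor_space Z) {y\<in>Z. Q y}"
    if "\<And>y. Q y \<longleftrightarrow> Q (y \<inter> {..<k})" for Q
  proof -
    have "openin cantor_space {y. Q y}"
      unfolding openin_cantor_space_iff by (metis mem_Collect_eq that)
    then show ?thesis
      unfolding openin_subtopology by (intro exI[of _ "{y. Q y}"]) auto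
  qed
  show "openin (subtopology cantor_space Z) {y\<in>Z. P y}" using op assms .
  have "openin (subtopology cantor_space Z) {y\<in>Z. \<not> P y}" using op assms by metis
  moreover have "topspace (subtopology cantor_space Z) - {y\<in>Z. P y} = {y\<in>Z. \<not> P y}" by auto
  ultimately show "closedin (subtopology cantor_space Z) {y\<in>Z. P y}"
    by (auto simp: closedin_def)
qed

text \<open>Finite unions of cylinders are countably many, and every finite subset of an open set
  lies in one of them that is still contained in the open set.\<close>

lemma omega_cover_countable_subcover:
  assumes "omega_cover (subtopology cantor_space X) \<U>"
  shows "\<exists>\<V>\<subseteq>\<U>. countable \<V> \<and> omega_cover (subtopology cantor_space X) \<V>"
proof -
  define N where "N D = X \<inter> (\<Union>d\<in>D. cylinder d)" for D
  define \<D> where "\<D> = {D. finite D \<and> (\<exists>U\<in>\<U>. N D \<subseteq> U)}"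
  \<comment> \<open>The choice is made for finite sets of codes, not of points, because only
    countably many of the former exist.\<close>
  have "\<forall>D. \<exists>U. D \<in> \<D> \<longrightarrow> U \<in> \<U> \<and> N D \<subseteq> U" by (auto simp: \<D>_def)
  then obtain c where c: "\<And>D. D \<in> \<D> \<Longrightarrow> c D \<in> \<U> \<and> N D \<subseteq> c D" by metis
  have sub: "c ` \<D> \<subseteq> \<U>" using c by auto
  have "countable \<D>"
    by (rule countable_subset[OF _ countable_Collect_finite]) (auto simp: \<D>_def)
  then have count: "countable (c ` \<D>)" by simp
  have fin: "\<exists>V\<in>c ` \<D>. F \<subseteq> V" if F: "finite F" "F \<subseteq> X" for F
  proof -
    obtain U where U: "U \<in> \<U>" "F \<subseteq> U"
      using assms F by (auto simp: omega_cover_def)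
    then obtain O' where O': "openin cantor_space O'" "U = O' \<inter> X"
      using assms by (auto simp: omega_cover_def open_cover_def openin_subtopology)
    have "\<forall>y\<in>F. \<exists>d. y \<in> cylinder d \<and> cylinder d \<subseteq> O'"
      using openin_cantor_space_cylinder[OF O'(1)] U O' by blast
    then obtain e where e: "\<And>y. y \<in> F \<Longrightarrow> y \<in> cylinder (e y) \<and> cylinder (e y) \<subseteq> O'" by metis
    have "N (e ` F) \<subseteq> U" using e O' by (auto simp: N_def)
    then have D: "e ` F \<in> \<D>" using F U by (auto simp: \<D>_def)
    moreover have "F \<subseteq> N (e ` F)" using e F by (auto simp: N_def)
    ultimately show ?thesis using c by blast
  qed
  have "x \<in> \<Union>(c ` \<D>)" if "x \<in> X" for x
    using fin[of "{x}"] that by auto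
  moreover have "\<Union>(c ` \<D>) \<subseteq> X"
    using sub assms by (auto simp: omega_cover_def open_cover_def)
  ultimately have "\<Union>(c ` \<D>) = X" by blast
  then have "open_cover (subtopology cantor_space X) (c ` \<D>)"
    using sub assms unfolding omega_cover_def open_cover_def by (simp add: subset_iff)
  moreover have "\<forall>U\<in>\<U>. \<not> topspace (subtopology cantor_space X) \<subseteq> U"
    using assms unfolding omega_cover_def by (elim conjE)
  then have "\<forall>V\<in>c ` \<D>. \<not> topspace (subtopology cantor_space X) \<subseteq> V"
    using sub by (meson subsetD)
  ultimately have "omega_cover (subtopology cantor_space X) (c ` \<D>)"
    using fin unfolding omega_cover_def by simp
  then show ?thesis using sub count by blast
qed

section \<open>Covers\<close>

text \<open>On the points, \<open>le\<close> is a total preorder, so a nonempty finite set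
  \<open>F\<close> has a least point \<open>x\<close>. Infinitely many members contain
  \<open>x\<close>, and all but finitely many of these contain all of \<open>F\<close>. For empty
  \<open>F\<close>, the point \<open>x\<^sub>0\<close> guarantees that some member exists.\<close>

lemma tau_cover_imp_omega_cover:
  assumes tau: "tau_cover Y \<U>" and ne: "x\<^sub>0 \<in> topspace Y"
  shows "omega_cover Y \<U>"
proof -
  define le where "le x y \<longleftrightarrow> finite {U\<in>\<U>. x \<in> U \<and> y \<notin> U}" for x y
  have trans: "le x z" if "le x y" "le y z" for x y z
    using that unfolding le_def
    by (rule finite_subset[OF _ finite_UnI, rotated]) auto
  have "\<exists>x\<in>F. \<forall>y\<in>F. le x y" if "finite F" "F \<noteq> {}" "F \<subseteq> topspace Y" for F
    using that
  proof (induction rule: finite_ne_induct)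
    case (singleton x)
    then show ?case by (simp add: le_def)
  next
    case (insert z F)
    then obtain x where x: "x \<in> F" "\<forall>y\<in>F. le x y" by auto
    have refl: "le z z" by (simp add: le_def)
    have "le x z \<or> le z x"
      using tau insert.prems x(1) unfolding tau_cover_def le_def by auto
    then show ?case using x trans refl by blast
  qed
  moreover have "\<exists>U\<in>\<U>. F \<subseteq> U" if F: "finite F" "x \<in> F" "\<forall>y\<in>F. le x y" "F \<subseteq> topspace Y" for F x
  proof -
    have "finite (\<Union>y\<in>F. {U\<in>\<U>. x \<in> U \<and> y \<notin> U})"
      using F by (auto simp: le_def)
    moreover have "infinite {U\<in>\<U>. x \<in> U}" using tau F by (auto simp: tau_cover_def)
    ultimately obtain U where "U \<in> {U\<in>\<U>. x \<in> U}" "U \<notin> (\<Union>y\<in>F. {U\<in>\<U>. x \<in> U \<and> y \<notin> U})"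
      by (meson finite_subset subsetI)
    then show ?thesis by auto
  qed
  moreover have "\<U> \<noteq> {}" using tau ne by (auto simp: tau_cover_def open_cover_def)
  ultimately have "\<exists>U\<in>\<U>. F \<subseteq> U" if "finite F" "F \<subseteq> topspace Y" for F
    using that by (cases "F = {}") blast+
  then show ?thesis using tau by (simp add: omega_cover_def tau_cover_def)
qed

text \<open>The selection principle is applied to the constant sequence of a countable
  \<omega>-subcover; what it selects is a \<gamma>-cover inside the given cover.\<close>

lemma S1_Omega_Gamma_imp_tau_set:
  assumes S1: "S1 Omega_covers Gamma_covers (subtopology cantor_space X)" and "X \<noteq> {}"
  shows "tau_set (subtopology cantor_space X)"
  unfolding tau_set_def
proof (intro allI impI, elim conjE)
  fix \<U> assume "tau_cover (subtopology cantor_space X) \<U>"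
  then have "omega_cover (subtopology cantor_space X) \<U>"
    using \<open>X \<noteq> {}\<close> by (auto intro: tau_cover_imp_omega_cover)
  then obtain \<V> where \<V>: "\<V> \<subseteq> \<U>" "\<V> \<in> Omega_covers (subtopology cantor_space X)"
    using omega_cover_countable_subcover unfolding Omega_covers_def by blast
  have "\<exists>U::nat \<Rightarrow> _. (\<forall>n. U n \<in> \<V>) \<and> {U n | n. True} \<in> Gamma_covers (subtopology cantor_space X)"
    by (rule mp[OF S1[unfolded S1_def, THEN spec, of "\<lambda>_. \<V>"]]) (simp add: \<V>(2))
  then obtain U where "\<And>n. U n \<in> \<V>" "{U n | n::nat. True} \<in> Gamma_covers (subtopology cantor_space X)"
    by blast
  then show "\<exists>\<V>\<subseteq>\<U>. gamma_cover (subtopology cantor_space X) \<V>"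
    using \<V>(1) by (intro exI[of _ "{U n | n. True}"]) (auto simp: Gamma_covers_def)
qed

lemma gamma_coverI_sequence:
  fixes U :: "nat \<Rightarrow> 'a set"
  assumes op: "\<And>n. openin Y (U n)" and proper: "\<And>n. \<not> topspace Y \<subseteq> U n"
    and ev: "\<And>x. x \<in> topspace Y \<Longrightarrow> \<forall>\<^sub>F n in sequentially. x \<in> U n"
  shows "gamma_cover Y (range U)"
proof -
  have fin: "finite {n. x \<notin> U n}" if "x \<in> topspace Y" for x
    using ev[OF that] by (simp flip: cofinite_eq_sequentially add: eventually_cofinite)
  \<comment> \<open>If repetitions made the range finite, one value would recur infinitely often and
    so contain every point, contrary to \<open>proper\<close>.\<close>
  have "infinite (range U)"
  proof
    assume "finite (range U)"
    then obtain n where n: "infinite {m. U m = U n}"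
      using pigeonhole_infinite[of UNIV U] by auto
    have "x \<in> U n" if x: "x \<in> topspace Y" for x
    proof -
      obtain m where "m \<in> {m. U m = U n}" "m \<notin> {n. x \<notin> U n}"
        using n fin[OF x] by (meson finite_subset subsetI)
      then show ?thesis by auto
    qed
    then show False using proper by blast
  qed
  moreover have "open_cover Y (range U)"
    unfolding open_cover_def
  proof (intro conjI ballI equalityI subsetI)
    fix x assume "x \<in> topspace Y"
    from eventually_happens[OF ev[OF this]] show "x \<in> \<Union>(range U)" by auto
  qed (use op openin_subset in blast)+
  moreover have "finite {V \<in> range U. x \<notin> V}" if "x \<in> topspace Y" for x
    by (rule finite_subset[OF _ finite_imageI[OF fin[OF that], of U]]) auto
  ultimately show ?thesis using proper by (auto simp: gamma_cover_def)
qed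

section \<open>Almost inclusion and pseudointersections\<close>

definition almost_subset :: "'a set \<Rightarrow> 'a set \<Rightarrow> bool" (infix \<open>\<subseteq>\<^sup>*\<close> 50) where
  "A \<subseteq>\<^sup>* B \<longleftrightarrow> finite (A - B)"

lemma almost_subset_refl [simp]: "A \<subseteq>\<^sup>* A"
  by (simp add: almost_subset_def)

lemma subset_imp_almost_subset: "A \<subseteq> B \<Longrightarrow> A \<subseteq>\<^sup>* B"
  unfolding almost_subset_def by (metis Diff_eq_empty_iff finite.emptyI)

lemma almost_subset_trans [trans]:
  assumes "A \<subseteq>\<^sup>* B" "B \<subseteq>\<^sup>* C" shows "A \<subseteq>\<^sup>* C"
  using assms unfolding almost_subset_def
  by (rule finite_subset[OF _ finite_UnI, rotated]) auto

lemma almost_subset_infinite: "A \<subseteq>\<^sup>* B \<Longrightarrow> infinite A \<Longrightarrow> infinite B"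
  unfolding almost_subset_def using finite_Diff2 by blast

section \<open>Families of fewer than continuum many sets\<close>

lemma infinite_UNIV_nat_set: "infinite (UNIV :: nat set set)"
  by (simp add: Finite_Set.finite_set)

lemma countable_ordLess_UNIV_nat_set:
  assumes "countable A" shows "|A| <o |UNIV :: nat set set|"
proof -
  have "|A| \<le>o |UNIV :: nat set|" using assms unfolding countable_def card_of_ordLeq[symmetric] by auto
  moreover have "|UNIV :: nat set| <o |UNIV :: nat set set|"
    using card_of_Pow[of "UNIV :: nat set"] by simp
  ultimately show ?thesis by (rule ordLeq_ordLess_trans)
qed

text \<open>The injection \<open>to_nat\<close> carries the family to subsets of \<open>nat\<close>,
  where a \<open>p_family\<close> would have at least continuum many members. General countable
  types are allowed because the argument is applied to sets of finite lists as well.\<close>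

lemma ex_pseudointersection:
  fixes \<F> :: "'i::countable set set"
  assumes p_eq_c: "pseudointersection_number =o continuum"
    and card: "|\<F>| <o |UNIV :: nat set set|"
    and fip: "\<And>\<G>. \<G> \<subseteq> \<F> \<Longrightarrow> finite \<G> \<Longrightarrow> infinite (\<Inter>\<G>)"
  shows "\<exists>P. infinite P \<and> (\<forall>A\<in>\<F>. P \<subseteq>\<^sup>* A)"
proof (cases "\<F> = {}")
  case True
  then show ?thesis using fip[of "{}"] by auto
next
  case False
  define \<F>' where "\<F>' = (\<lambda>A. to_nat ` A) ` \<F>"
  have "strong_fip \<F>'"
    unfolding strong_fip_def
  proof (intro allI impI, elim conjE)
    fix \<G>' assume \<G>': "\<G>' \<subseteq> \<F>'" "finite \<G>'" "\<G>' \<noteq> {}"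
    then obtain \<G> where \<G>: "\<G> \<subseteq> \<F>" "finite \<G>" "\<G>' = (\<lambda>A. to_nat ` A) ` \<G>"
      unfolding \<F>'_def by (meson finite_subset_image)
    then have "\<G> \<noteq> {}" using \<G>' by auto
    then have "\<Inter>\<G>' = to_nat ` \<Inter>\<G>"
      unfolding \<G>(3) using image_INT[of to_nat UNIV \<G> "\<lambda>A. A"] by auto
    then show "infinite (\<Inter>\<G>')"
      using fip[OF \<G>(1,2)] by (simp add: finite_image_iff)
  qed
  moreover have "\<not> p_family \<F>'"
  proof
    assume "p_family \<F>'"
    then have "pseudointersection_number \<le>o |\<F>'|" by (rule pseudointersection_number_props(2))
    also have "|\<F>'| \<le>o |\<F>|" unfolding \<F>'_def by (rule card_of_image)
    also note card
    also have "|UNIV :: nat set set| =o pseudointersection_number"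
      using ordIso_transitive[OF p_eq_c continuum_ordIso] by (rule ordIso_symmetric)
    finally show False using ordLess_irreflexive by blast
  qed
  ultimately obtain P' where P': "infinite P'" "\<And>A. A \<in> \<F> \<Longrightarrow> finite (P' - to_nat ` A)"
    unfolding p_family_def pseudointersection_def \<F>'_def by auto
  \<comment> \<open>Part of \<open>P'\<close> may lie outside the range of \<open>to_nat\<close>.
    Since \<open>\<F>\<close> has a member, that part is finite, and the preimage stays
    infinite.\<close>
  define P where "P = (to_nat -` P' :: 'i set)"
  have image: "to_nat ` P = P' \<inter> range (to_nat :: 'i \<Rightarrow> nat)" by (auto simp: P_def)
  have "finite (P - A)" if "A \<in> \<F>" for A
  proof -
    have "to_nat ` (P - A) \<subseteq> P' - to_nat ` A" by (auto simp: P_def)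
    then have "finite (to_nat ` (P - A))" using P'(2)[OF that] finite_subset by blast
    then show ?thesis by (simp add: finite_image_iff)
  qed
  moreover have "infinite P"
  proof
    assume "finite P"
    then have fin: "finite (P' \<inter> range (to_nat :: 'i \<Rightarrow> nat))" by (simp flip: image)
    obtain A where "A \<in> \<F>" using False by auto
    then have "finite (P' - to_nat ` A)" by (rule P'(2))
    with fin have "finite (P' \<inter> range (to_nat :: 'i \<Rightarrow> nat) \<union> (P' - to_nat ` A))" by simp
    moreover have "P' \<subseteq> P' \<inter> range (to_nat :: 'i \<Rightarrow> nat) \<union> (P' - to_nat ` A)" by auto
    ultimately show False using P'(1) finite_subset by blast
  qed
  ultimately show ?thesis by (auto simp: almost_subset_def)
qed

section \<open>One step of the tower\<close>

text \<open>A list \<open>s\<close> picks one member from each of the first \<open>length s\<close>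
  families. Finite selections form a countable type, so pseudointersections of sets of selections
  are available.\<close>

definition selection_inter :: "(nat \<Rightarrow> nat \<Rightarrow> 'a set) \<Rightarrow> nat list \<Rightarrow> 'a set" where
  "selection_inter U s = (\<Inter>i<length s. U i (s ! i))"

lemma openin_selection_inter:
  assumes "\<And>n m. openin cantor_space (U n m)"
  shows "openin cantor_space (selection_inter U s)"
proof (cases "s = []")
  case True
  then show ?thesis
    using openin_topspace[of cantor_space] by (simp add: selection_inter_def)
next
  case False
  then show ?thesis
    unfolding selection_inter_def using assms by (intro openin_INT2) auto
qed

text \<open>The members are subsets of the whole space, not traces on \<open>Y\<close>, and none is
  required to omit a point; hence the constant family \<open>UNIV\<close> qualifies.\<close>

definition omega_on :: "'a set \<Rightarrow> (nat \<Rightarrow> nat \<Rightarrow> 'a set) \<Rightarrow> bool" where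
  "omega_on Y U \<longleftrightarrow> (\<forall>n F. finite F \<and> F \<subseteq> Y \<longrightarrow> (\<exists>m. F \<subseteq> U n m))"

text \<open>\<open>P\<close> is a pseudointersection of the sets \<open>A y\<close> of selections
  good for \<open>y\<close>, together with the sets \<open>C n\<close>, which force the lengths to
  grow.\<close>

lemma omega_on_selections:
  assumes p_eq_c: "pseudointersection_number =o continuum"
    and card: "|Y| <o |UNIV :: nat set set|" and omega: "omega_on Y U"
  shows "\<exists>P. infinite P \<and> (\<forall>n. finite {s\<in>P. length s \<le> n}) \<and>
    (\<forall>y\<in>Y. finite {s\<in>P. y \<notin> selection_inter U s})"
proof -
  define A where "A y = {s. y \<in> selection_inter U s}" for y
  define C :: "nat \<Rightarrow> nat list set" where "C n = {s. n < length s}" for n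
  have "|A ` Y| <o |UNIV :: nat set set|"
    using card_of_image card by (rule ordLeq_ordLess_trans)
  then have small: "|A ` Y \<union> range C| <o |UNIV :: nat set set|"
    by (rule card_of_Un_ordLess_infinite[OF infinite_UNIV_nat_set])
      (simp add: countable_ordLess_UNIV_nat_set)
  have "infinite (\<Inter>\<G>)" if \<G>: "\<G> \<subseteq> A ` Y \<union> range C" "finite \<G>" for \<G>
  proof -
    obtain F where F: "F \<subseteq> Y" "finite F" "\<G> \<inter> A ` Y = A ` F"
      using finite_subset_image[of "\<G> \<inter> A ` Y" A Y] \<G> by auto
    obtain M where M: "finite M" "\<G> \<inter> range C = C ` M"
      using finite_subset_image[of "\<G> \<inter> range C" C UNIV] \<G> by auto
    have "\<G> = \<G> \<inter> A ` Y \<union> \<G> \<inter> range C" using \<G>(1) by blast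
    then have \<G>_eq: "\<G> = A ` F \<union> C ` M" using F(3) M(2) by simp
    obtain k where k: "\<And>n. n \<in> M \<Longrightarrow> n < k"
      using M(1) finite_nat_iff_bounded by (meson lessThan_iff subsetD)
    have "\<exists>m. F \<subseteq> U n m" for n
      using omega F by (auto simp: omega_on_def)
    then obtain g where g: "\<And>n. F \<subseteq> U n (g n)" by metis
    \<comment> \<open>All initial segments of the single choice \<open>g\<close> are good for
      \<open>F\<close>; from length \<open>k\<close> on they also meet the length demands.\<close>
    have "map g [0..<k + j] \<in> \<Inter>\<G>" for j
      using g k unfolding \<G>_eq A_def C_def selection_inter_def by force
    then have "range (\<lambda>j. map g [0..<k + j]) \<subseteq> \<Inter>\<G>" by blast
    moreover have "inj (\<lambda>j. map g [0..<k + j])"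
      by (rule injI, drule arg_cong[where f = length]) simp
    then have "infinite (range (\<lambda>j. map g [0..<k + j]))" by (rule range_inj_infinite)
    ultimately show ?thesis using finite_subset by blast
  qed
  then obtain P where P: "infinite P" "\<forall>B\<in>A ` Y \<union> range C. P \<subseteq>\<^sup>* B"
    using ex_pseudointersection[OF p_eq_c small] by blast
  have "{s\<in>P. length s \<le> n} = P - C n" for n by (auto simp: C_def)
  moreover have "{s\<in>P. y \<notin> selection_inter U s} = P - A y" for y by (auto simp: A_def)
  ultimately show ?thesis using P by (auto simp: almost_subset_def)
qed

text \<open>A set which misses the interval between \<open>h\<close> and \<open>e\<close> looks, below \<open>e\<close>, like one of the
  finitely many subsets of \<open>{..<h}\<close>. Hence an open set that contains all of these also contains
  every set with a long enough gap after \<open>h\<close>; the elements of \<open>a\<close> are placed so as to leave such gaps.\<close>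

lemma sparse_subset_gamma:
  fixes f :: "nat \<Rightarrow> nat" and W :: "'i list \<Rightarrow> nat set set"
  assumes b: "infinite b" and P: "infinite P"
    and len: "\<And>n. finite {s\<in>P. length s \<le> n}"
    and op: "\<And>s. openin cantor_space (W s)"
    and Fin: "\<And>y. finite y \<Longrightarrow> finite {s\<in>P. y \<notin> W s}"
  shows "\<exists>a s. a \<subseteq> b \<and> infinite a \<and> (\<forall>n. card (a \<inter> {..f n}) \<le> n) \<and>
    (\<forall>j::nat. s j \<in> P \<and> j < length (s j)) \<and> (\<forall>y. y \<subseteq>\<^sup>* a \<longrightarrow> (\<forall>\<^sub>F j in sequentially. y \<in> W (s j)))"
proof -
  \<comment> \<open>Here \<open>h\<close> is the bound reached so far, \<open>e\<close> the next
    element of \<open>a\<close>, and \<open>s\<close> a selection that accepts every set missing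
    \<open>{h..<e}\<close>.\<close>
  have "\<exists>s e. s \<in> P \<and> j < length s \<and> e \<in> b \<and> h \<le> e \<and> (\<forall>i\<le>j. f i < e) \<and>
    (\<forall>y. y \<inter> {h..<e} = {} \<longrightarrow> y \<in> W s)" for j h :: nat
  proof -
    have "finite (\<Union>F\<in>Pow {..<h}. {s\<in>P. F \<notin> W s})"
      using Fin finite_subset by (intro finite_UN_I) auto
    then have "finite ((\<Union>F\<in>Pow {..<h}. {s\<in>P. F \<notin> W s}) \<union> {s\<in>P. length s \<le> j})"
      using len by blast
    then obtain s where "s \<in> P" "s \<notin> (\<Union>F\<in>Pow {..<h}. {s\<in>P. F \<notin> W s}) \<union> {s\<in>P. length s \<le> j}"
      using P by (meson finite_subset subsetI)
    then have s: "s \<in> P" "j < length s" "\<And>F. F \<subseteq> {..<h} \<Longrightarrow> F \<in> W s" by auto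
    have "\<exists>k. \<forall>z. z \<inter> {..<k} = F \<inter> {..<k} \<longrightarrow> z \<in> W s" if "F \<subseteq> {..<h}" for F
      using op[of s, unfolded openin_cantor_space_iff] s(3)[OF that] by (rule bspec)
    then obtain k where k: "\<And>F z. F \<subseteq> {..<h} \<Longrightarrow> z \<inter> {..<k F} = F \<inter> {..<k F} \<Longrightarrow> z \<in> W s"
      by metis
    \<comment> \<open>The first maximum bounds the coordinates that decide membership in
      \<open>W s\<close> near subsets of \<open>{..<h}\<close>; the second, with the final 1, makes
      \<open>e\<close> exceed \<open>f i\<close> for all \<open>i \<le> j\<close>.\<close>
    define m where "m = h + Max (k ` Pow {..<h}) + Max (f ` {..j}) + 1"
    obtain e where e: "e \<in> b" "m \<le> e"
      using b by (meson infinite_nat_iff_unbounded_le)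
    have "f i < e" if "i \<le> j" for i
    proof -
      have "f i \<le> Max (f ` {..j})" using that by (intro Max_ge) auto
      then show ?thesis using e(2) by (simp add: m_def)
    qed
    moreover have "y \<in> W s" if y: "y \<inter> {h..<e} = {}" for y
    proof (rule k)
      show "y \<inter> {..<h} \<subseteq> {..<h}" by simp
      have "k (y \<inter> {..<h}) \<le> Max (k ` Pow {..<h})" by (intro Max_ge) auto
      also have "\<dots> \<le> e" using e(2) by (simp add: m_def)
      finally have "k (y \<inter> {..<h}) \<le> e" .
      then show "y \<inter> {..<k (y \<inter> {..<h})} = (y \<inter> {..<h}) \<inter> {..<k (y \<inter> {..<h})}"
        using y by (auto simp: disjoint_iff not_less[symmetric])
    qed
    moreover have "h \<le> e" using e(2) by (simp add: m_def)
    ultimately show ?thesis using s e(1) by blast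
  qed
  then obtain \<sigma> \<epsilon> where step: "\<And>j h. \<sigma> j h \<in> P \<and> j < length (\<sigma> j h) \<and> \<epsilon> j h \<in> b \<and> h \<le> \<epsilon> j h \<and>
    (\<forall>i\<le>j. f i < \<epsilon> j h) \<and> (\<forall>y. y \<inter> {h..<\<epsilon> j h} = {} \<longrightarrow> y \<in> W (\<sigma> j h))"
    by metis
  \<comment> \<open>Each gap starts just after the preceding element; the first starts at 0.\<close>
  define h where "h = rec_nat 0 (\<lambda>j k. Suc (\<epsilon> j k))"
  define e where "e j = \<epsilon> j (h j)" for j
  define s where "s j = \<sigma> j (h j)" for j
  have h_Suc: "h (Suc j) = Suc (e j)" for j by (simp add: h_def e_def)
  have h_le: "h j \<le> e j" for j using step by (simp add: e_def)
  have W: "y \<in> W (s j)" if "y \<inter> {h j..<e j} = {}" for y j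
    using step that by (simp add: e_def s_def)
  have f_less: "f i < e j" if "i \<le> j" for i j using step that by (simp add: e_def)
  have "strict_mono e"
    unfolding strict_mono_Suc_iff using h_Suc h_le by (metis Suc_le_lessD)
  have "strict_mono h"
    unfolding strict_mono_Suc_iff using h_Suc h_le by (simp add: less_Suc_eq_le)
  have "infinite (range e)"
    using \<open>strict_mono e\<close> by (simp add: range_inj_infinite strict_mono_imp_inj_on)
  moreover have "range e \<subseteq> b" using step by (auto simp: e_def)
  moreover have "card (range e \<inter> {..f n}) \<le> n" for n
  proof -
    \<comment> \<open>\<open>e n\<close> and all later elements exceed \<open>f n\<close>, which
      leaves only the \<open>n\<close> elements of smaller index.\<close>
    have "range e \<inter> {..f n} \<subseteq> e ` {..<n}"
    proof
      fix z assume "z \<in> range e \<inter> {..f n}"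
      then obtain j where "z = e j" "e j \<le> f n" by auto
      moreover from this have "j < n" using f_less[of n j] by (meson leD leI)
      ultimately show "z \<in> e ` {..<n}" by simp
    qed
    then have "card (range e \<inter> {..f n}) \<le> card (e ` {..<n})" by (intro card_mono) auto
    also have "\<dots> \<le> n" using card_image_le[of "{..<n}" e] by simp
    finally show ?thesis .
  qed
  moreover have "s j \<in> P \<and> j < length (s j)" for j using step by (simp add: s_def)
  moreover have "\<forall>\<^sub>F j in sequentially. y \<in> W (s j)" if y: "y \<subseteq>\<^sup>* range e" for y
  proof -
    obtain m where m: "y - range e \<subseteq> {..<m}"
      using y unfolding almost_subset_def by (meson finite_nat_iff_bounded)
    \<comment> \<open>Since \<open>j \<le> h j\<close>, a point of \<open>y\<close> in the gap would
      be at least \<open>m\<close>, hence a value of \<open>e\<close>; but no value of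
      \<open>e\<close> falls into a gap.\<close>
    have "y \<in> W (s j)" if "m \<le> j" for j
    proof (rule W, rule ccontr)
      assume "y \<inter> {h j..<e j} \<noteq> {}"
      then obtain z where z: "z \<in> y" "h j \<le> z" "z < e j" by auto
      have "j \<le> h j" using \<open>strict_mono h\<close> by (rule strict_mono_imp_increasing)
      then have "z \<in> range e" using m z that by auto
      then obtain i where i: "z = e i" by auto
      with z(3) have "i < j" using \<open>strict_mono e\<close> by (simp add: strict_mono_less)
      then have "h (Suc i) \<le> h j" using \<open>strict_mono h\<close> by (simp add: strict_mono_less_eq)
      with z(2) i show False by (simp add: h_Suc)
    qed
    then show ?thesis unfolding eventually_sequentially by blast
  qed
  ultimately show ?thesis by blast
qed

text \<open>The selections in \<open>P\<close> serve the points of \<open>Y\<close>, and thinning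
  \<open>b\<close> serves the almost-subsets of \<open>a\<close>. The sequence of finite selections
  is then unravelled into one member per family.\<close>

lemma tower_step:
  fixes f :: "nat \<Rightarrow> nat"
  assumes p_eq_c: "pseudointersection_number =o continuum"
    and card: "|Y| <o |UNIV :: nat set set|" and Fin: "Fin \<subseteq> Y"
    and b: "infinite b" and op: "\<And>n m. openin cantor_space (U n m)" and omega: "omega_on Y U"
  shows "\<exists>a\<subseteq>b. infinite a \<and> (\<forall>n. card (a \<inter> {..f n}) \<le> n) \<and>
    (\<exists>g. \<forall>y. y \<in> Y \<or> y \<subseteq>\<^sup>* a \<longrightarrow> (\<forall>\<^sub>F n in sequentially. y \<in> U n (g n)))"
proof -
  let ?W = "selection_inter U"
  obtain P where P: "infinite P" "\<And>n. finite {s\<in>P. length s \<le> n}"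
      "\<And>y. y \<in> Y \<Longrightarrow> finite {s\<in>P. y \<notin> ?W s}"
    using omega_on_selections[OF p_eq_c card omega] by blast
  have "finite {s\<in>P. y \<notin> ?W s}" if "finite y" for y
    using P(3) Fin that by (auto simp: Fin_def)
  note sparse_subset_gamma[OF b P(1,2) openin_selection_inter[OF op] this, of f]
  then obtain a s where a: "a \<subseteq> b" "infinite a" "\<forall>n. card (a \<inter> {..f n}) \<le> n"
    and s: "\<And>j::nat. s j \<in> P" "\<And>j. j < length (s j)"
    and ev: "\<And>y. y \<subseteq>\<^sup>* a \<Longrightarrow> \<forall>\<^sub>F j in sequentially. y \<in> ?W (s j)"
    by blast
  have evY: "\<forall>\<^sub>F j in sequentially. y \<in> ?W (s j)" if "y \<in> Y" for y
  proof -
    \<comment> \<open>A bad selection \<open>t\<close> can equal \<open>s j\<close> only for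
      \<open>j < length t\<close>, so finitely many bad selections give finitely many bad
      indices.\<close>
    have "{j. y \<notin> ?W (s j)} \<subseteq> (\<Union>t\<in>{s\<in>P. y \<notin> ?W s}. {..<length t})"
      using s by auto
    then have "finite {j. y \<notin> ?W (s j)}"
      using P(3)[OF that] by (meson finite_UN_I finite_lessThan finite_subset)
    then show ?thesis by (simp flip: cofinite_eq_sequentially add: eventually_cofinite)
  qed
  \<comment> \<open>The member of family \<open>n\<close> is read off the first selection long
    enough to have an entry at \<open>n\<close>.\<close>
  define J where "J n = (LEAST j. n < length (s j))" for n
  define g where "g n = s (J n) ! n" for n
  have J: "n < length (s (J n))" for n
    unfolding J_def using s(2)[of n] by (rule LeastI)
  have "\<forall>\<^sub>F n in sequentially. y \<in> U n (g n)" if y: "\<forall>\<^sub>F j in sequentially. y \<in> ?W (s j)" for y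
  proof -
    obtain N where N: "\<And>j. N \<le> j \<Longrightarrow> y \<in> ?W (s j)"
      using y unfolding eventually_sequentially by blast
    \<comment> \<open>Once \<open>n\<close> reaches the total length of the first \<open>N\<close>
      selections, none of them has an entry at \<open>n\<close>.\<close>
    have "y \<in> U n (g n)" if n: "(\<Sum>j<N. length (s j)) \<le> n" for n
    proof -
      have "N \<le> J n"
      proof (rule ccontr)
        assume "\<not> N \<le> J n"
        then have "length (s (J n)) \<le> (\<Sum>j<N. length (s j))"
          by (intro member_le_sum) auto
        then show False using J[of n] n by simp
      qed
      from N[OF this] J[of n] show ?thesis by (auto simp: selection_inter_def g_def)
    qed
    then show ?thesis unfolding eventually_sequentially by blast
  qed
  then have "\<forall>y. y \<in> Y \<or> y \<subseteq>\<^sup>* a \<longrightarrow> (\<forall>\<^sub>F n in sequentially. y \<in> U n (g n))"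
    using ev evY by blast
  then show ?thesis using a by blast
qed

section \<open>The tower\<close>

text \<open>Every set \<open>t\<close> of natural numbers codes a double sequence of open sets and a function;
  the two components are never needed simultaneously, so they may share the code.\<close>

definition task_open :: "nat set \<Rightarrow> nat \<Rightarrow> nat \<Rightarrow> nat set set" where
  "task_open t n m = (\<Union>d\<in>{d. to_nat (n, m, d) \<in> t}. cylinder d)"

definition task_fun :: "nat set \<Rightarrow> nat \<Rightarrow> nat" where
  "task_fun t n = (LEAST i. to_nat (n, 0 :: nat, i) \<in> t)"

lemma openin_task_open: "openin cantor_space (task_open t n m)"
  unfolding task_open_def by (intro openin_Union) (auto simp: openin_cylinder)

lemma task_open_surj:
  assumes "\<And>n m. openin cantor_space (U n m)"
  shows "\<exists>t. task_open t = U"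
proof -
  have "\<forall>n m. \<exists>D. U n m = (\<Union>d\<in>D. cylinder d)"
    using openin_cantor_space_eq_UN_cylinder assms by blast
  then obtain D where D: "\<And>n m. U n m = (\<Union>d\<in>D n m. cylinder d)" by metis
  have "task_open {to_nat (n, m, d) | n m d. d \<in> D n m} = U"
    by (intro ext) (simp add: task_open_def D)
  then show ?thesis by blast
qed

lemma task_fun_surj: "\<exists>t. task_fun t = f"
proof
  show "task_fun {to_nat (n, 0 :: nat, f n) | n. True} = f"
    by (rule ext) (simp add: task_fun_def Least_equality)
qed

text \<open>Closure under finite modifications will make the sets
  \<open>{x\<in>Z. n \<in> x}\<close> distinct and proper once \<open>Fin\<close> is
  removed.\<close>

definition stage_set :: "('t \<Rightarrow> nat set) \<Rightarrow> 't set \<Rightarrow> nat set set" where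
  "stage_set x T = Fin \<union> {y. \<exists>t\<in>T. y \<subseteq>\<^sup>* x t \<and> x t \<subseteq>\<^sup>* y}"

lemma stage_set_cong: "(\<And>t. t \<in> T \<Longrightarrow> x t = x' t) \<Longrightarrow> stage_set x T = stage_set x' T"
  by (auto simp: stage_set_def)

text \<open>A finite modification of \<open>x t\<close> has the form
  \<open>(x t - A) \<union> B\<close> with \<open>A\<close>, \<open>B\<close> finite, and only
  countably many such pairs exist.\<close>

lemma card_stage_set:
  assumes "|T| <o |UNIV :: nat set set|"
  shows "|stage_set x T| <o |UNIV :: nat set set|"
proof -
  have countable_Fin: "countable Fin" unfolding Fin_def by (rule countable_Collect_finite)
  let ?F = "Fin \<times> Fin"
  have "|T \<times> ?F| <o |UNIV :: nat set set|"
  proof (cases "countable T")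
    case True
    then show ?thesis using countable_Fin by (intro countable_ordLess_UNIV_nat_set) auto
  next
    case False
    then have inf: "infinite T" using countable_finite by blast
    have "|?F| \<le>o |UNIV :: nat set|"
      using countable_Fin unfolding card_of_ordLeq[symmetric] by (auto simp flip: countable_def)
    also have "|UNIV :: nat set| \<le>o |T|" using inf infinite_iff_card_of_nat by blast
    finally have le: "|?F| \<le>o |T|" .
    have "?F \<noteq> {}" by (auto simp: Fin_def)
    from card_of_Times_infinite[OF inf this le] have "|T \<times> ?F| =o |T|" by blast
    then show ?thesis using assms by (rule ordIso_ordLess_trans)
  qed
  then have small: "|(\<lambda>(t, A, B). (x t - A) \<union> B) ` (T \<times> ?F)| <o |UNIV :: nat set set|"
    by (rule ordLeq_ordLess_trans[OF card_of_image])
  have "stage_set x T \<subseteq> Fin \<union> (\<lambda>(t, A, B). (x t - A) \<union> B) ` (T \<times> ?F)"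
  proof
    fix y assume "y \<in> stage_set x T"
    then consider "y \<in> Fin" | t where "t \<in> T" "finite (y - x t)" "finite (x t - y)"
      unfolding stage_set_def almost_subset_def by auto
    then show "y \<in> Fin \<union> (\<lambda>(t, A, B). (x t - A) \<union> B) ` (T \<times> ?F)"
    proof cases
      case 2
      then have "(t, x t - y, y - x t) \<in> T \<times> ?F" by (simp add: Fin_def)
      then have "(\<lambda>(t, A, B). (x t - A) \<union> B) (t, x t - y, y - x t)
          \<in> (\<lambda>(t, A, B). (x t - A) \<union> B) ` (T \<times> ?F)"
        by (rule imageI)
      moreover have "(\<lambda>(t, A, B). (x t - A) \<union> B) (t, x t - y, y - x t) = y" by auto
      ultimately show ?thesis by (simp only: UnI2)
    qed simp
  qed
  then have "|stage_set x T| \<le>o |Fin \<union> (\<lambda>(t, A, B). (x t - A) \<union> B) ` (T \<times> ?F)|"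
    by (rule card_of_mono1)
  moreover have "|Fin \<union> (\<lambda>(t, A, B). (x t - A) \<union> B) ` (T \<times> ?F)| <o |UNIV :: nat set set|"
    using countable_ordLess_UNIV_nat_set[OF countable_Fin] small
    by (rule card_of_Un_ordLess_infinite[OF infinite_UNIV_nat_set])
  ultimately show ?thesis by (rule ordLeq_ordLess_trans)
qed

text \<open>A finite chain has a least member, and the intersection omits only finitely many of its
  elements.\<close>

lemma almost_subset_chain_infinite_Inter:
  assumes chain: "\<And>s t. s \<in> T \<Longrightarrow> t \<in> T \<Longrightarrow> x s \<subseteq>\<^sup>* x t \<or> x t \<subseteq>\<^sup>* x s"
    and inf: "\<And>t. t \<in> T \<Longrightarrow> infinite (x t)" and T: "finite T" "T \<noteq> {}"
  shows "infinite (\<Inter>t\<in>T. x t)"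
proof -
  have "\<exists>t\<in>T. \<forall>s\<in>T. x t \<subseteq>\<^sup>* x s"
    using T chain
  proof (induction rule: finite_ne_induct)
    case (insert u T)
    then obtain t where t: "t \<in> T" "\<forall>s\<in>T. x t \<subseteq>\<^sup>* x s" by auto
    have "x t \<subseteq>\<^sup>* x u \<or> x u \<subseteq>\<^sup>* x t" using insert.prems t(1) by blast
    then show ?case
    proof
      assume "x t \<subseteq>\<^sup>* x u"
      then show ?thesis using t by blast
    next
      assume "x u \<subseteq>\<^sup>* x t"
      then have "\<forall>s\<in>insert u T. x u \<subseteq>\<^sup>* x s" using t almost_subset_trans by auto
      then show ?thesis by blast
    qed
  qed simp
  then obtain t where t: "t \<in> T" "\<And>s. s \<in> T \<Longrightarrow> x t \<subseteq>\<^sup>* x s" by blast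
  have "x t - (\<Inter>s\<in>T. x s) = (\<Union>s\<in>T. x t - x s)" using T by auto
  moreover have "finite (\<Union>s\<in>T. x t - x s)" 
    using T(1) t(2) unfolding almost_subset_def by (rule finite_UN_I)
  ultimately have "x t \<subseteq>\<^sup>* (\<Inter>s\<in>T. x s)" by (simp only: almost_subset_def)
  then show ?thesis using inf[OF t(1)] by (rule almost_subset_infinite)
qed

lemma ex_tower:
  assumes p_eq_c: "pseudointersection_number =o continuum"
  defines "r \<equiv> |UNIV :: nat set set|"
  shows "\<exists>x. \<forall>t. infinite (x t) \<and> (\<forall>u\<in>underS r t. x t \<subseteq>\<^sup>* x u) \<and>
    (\<forall>n. card (x t \<inter> {..task_fun t n}) \<le> n) \<and>
    (omega_on (stage_set x (underS r t)) (task_open t) \<longrightarrow>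
      (\<exists>g. \<forall>y. y \<in> stage_set x (underS r t) \<or> y \<subseteq>\<^sup>* x t \<longrightarrow>
        (\<forall>\<^sub>F n in sequentially. y \<in> task_open t n (g n))))"
proof -
  \<comment> \<open>The requirement at \<open>t\<close> uses \<open>x\<close> only below
    \<open>t\<close>, with the new value as a separate argument; well-founded choice needs this
    form.\<close>
  define Q where "Q x t a \<longleftrightarrow> infinite a \<and> (\<forall>u\<in>underS r t. a \<subseteq>\<^sup>* x u) \<and>
    (\<forall>n. card (a \<inter> {..task_fun t n}) \<le> n) \<and>
    (omega_on (stage_set x (underS r t)) (task_open t) \<longrightarrow>
      (\<exists>g. \<forall>y. y \<in> stage_set x (underS r t) \<or> y \<subseteq>\<^sup>* a \<longrightarrow>
        (\<forall>\<^sub>F n in sequentially. y \<in> task_open t n (g n))))" for x t a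
  have wo: "well_order_on UNIV r" unfolding r_def by (rule card_of_well_order_on)
  then have total: "(s, t) \<in> r \<or> (t, s) \<in> r" if "s \<noteq> t" for s t
    using that by (auto simp: well_order_on_def linear_order_on_def total_on_def)
  have "\<exists>x. \<forall>t. Q x t (x t)"
  proof (rule dependent_wf_choice[of "r - Id"])
    show "wf (r - Id)" using wo by (simp add: well_order_on_def)
  next
    fix x x' :: "nat set \<Rightarrow> nat set" and t a
    assume "\<And>u. (u, t) \<in> r - Id \<Longrightarrow> x u = x' u"
    then have eq: "x u = x' u" if "u \<in> underS r t" for u
      using that by (auto simp: underS_def)
    then have "stage_set x (underS r t) = stage_set x' (underS r t)" by (rule stage_set_cong)
    then show "Q x t a = Q x' t a" unfolding Q_def using eq by simp
  next
    fix t x assume "\<And>u. (u, t) \<in> r - Id \<Longrightarrow> Q x u (x u)"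
    then have IH: "Q x u (x u)" if "u \<in> underS r t" for u
      using that by (auto simp: underS_def)
    let ?T = "underS r t"
    let ?Y = "stage_set x ?T"
    \<comment> \<open>As \<open>r\<close> is a cardinal order, fewer than continuum many steps
      precede \<open>t\<close>, so pseudointersections exist both for the earlier members and for
      the stage.\<close>
    have T: "|?T| <o |UNIV :: nat set set|"
      unfolding r_def by (rule card_of_underS[OF card_of_Card_order]) (simp add: Field_card_of)
    have chain: "x s \<subseteq>\<^sup>* x u \<or> x u \<subseteq>\<^sup>* x s" if su: "s \<in> ?T" "u \<in> ?T" for s u
    proof (cases "s = u")
      case False
      then have "s \<in> underS r u \<or> u \<in> underS r s" using total by (auto simp: underS_def)
      then show ?thesis using IH su unfolding Q_def by blast
    qed simp
    have "infinite (\<Inter>\<G>)" if \<G>: "\<G> \<subseteq> x ` ?T" "finite \<G>" for \<G>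
    proof (cases "\<G> = {}")
      case False
      obtain T' where T': "T' \<subseteq> ?T" "finite T'" "\<G> = x ` T'"
        using finite_subset_image[OF \<G>(2,1)] by blast
      show ?thesis unfolding T'(3)
      proof (rule almost_subset_chain_infinite_Inter)
        show "infinite (x u)" if "u \<in> T'" for u using IH that T' unfolding Q_def by blast
        show "T' \<noteq> {}" using False T' by auto
      qed (use chain T' in blast)+
    qed simp
    moreover have "|x ` ?T| <o |UNIV :: nat set set|"
      using card_of_image T by (rule ordLeq_ordLess_trans)
    ultimately obtain b where b: "infinite b" "\<forall>A\<in>x ` ?T. b \<subseteq>\<^sup>* A"
      using ex_pseudointersection[OF p_eq_c] by blast
    \<comment> \<open>If \<open>t\<close> does not code \<omega>-covers of the stage, trivial
      families stand in, so that a sparse set below the earlier members is still obtained.\<close>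
    define U where "U = (if omega_on ?Y (task_open t) then task_open t else (\<lambda>_ _. UNIV))"
    have op: "openin cantor_space (U n m)" for n m
      using openin_topspace[of cantor_space] by (simp add: U_def openin_task_open)
    have omega: "omega_on ?Y U" by (simp add: U_def omega_on_def)
    have "Fin \<subseteq> ?Y" by (simp add: stage_set_def)
    from tower_step[OF p_eq_c card_stage_set[OF T] this b(1) op omega, of "task_fun t"]
    obtain a where a: "a \<subseteq> b" "infinite a" "\<forall>n. card (a \<inter> {..task_fun t n}) \<le> n"
      "\<exists>g. \<forall>y. y \<in> ?Y \<or> y \<subseteq>\<^sup>* a \<longrightarrow> (\<forall>\<^sub>F n in sequentially. y \<in> U n (g n))"
      by blast
    have "a \<subseteq>\<^sup>* x u" if "u \<in> ?T" for u
      using almost_subset_trans[OF subset_imp_almost_subset[OF a(1)]] b(2) that by blast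
    moreover have "\<exists>g. \<forall>y. y \<in> ?Y \<or> y \<subseteq>\<^sup>* a \<longrightarrow> (\<forall>\<^sub>F n in sequentially. y \<in> task_open t n (g n))"
      if "omega_on ?Y (task_open t)"
      using a(4) unfolding U_def if_P[OF that] .
    ultimately have "Q x t a" using a(2,3) unfolding Q_def by blast
    then show "\<exists>a. Q x t a" ..
  qed
  then show ?thesis unfolding Q_def .
qed

text \<open>A sequence of covers of \<open>X\<close> is coded by some \<open>t\<close>. Every point
  of \<open>X\<close> lies in the stage before \<open>t\<close> or is almost contained in
  \<open>x t\<close>, so the choice made at \<open>t\<close> works for all of \<open>X\<close>. The
  other conjuncts are what the removal of \<open>Fin\<close> relies on.\<close>

lemma ex_S1_tower_set:
  assumes p_eq_c: "pseudointersection_number =o continuum"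
  shows "\<exists>X. S1 Omega_covers Gamma_covers (subtopology cantor_space X) \<and> Fin \<subseteq> X \<and>
    (\<forall>x\<in>X - Fin. \<forall>y\<in>X - Fin. x \<subseteq>\<^sup>* y \<or> y \<subseteq>\<^sup>* x) \<and>
    (\<forall>x\<in>X. \<forall>y. x \<subseteq>\<^sup>* y \<and> y \<subseteq>\<^sup>* x \<longrightarrow> y \<in> X) \<and>
    (\<forall>f. \<exists>x\<in>X - Fin. \<forall>n. card (x \<inter> {..f n}) \<le> n)"
proof -
  define r where "r = |UNIV :: nat set set|"
  obtain x where x_inf: "\<And>t. infinite (x t)"
    and x_dec: "\<And>t u. u \<in> underS r t \<Longrightarrow> x t \<subseteq>\<^sup>* x u"
    and x_sparse: "\<And>t n. card (x t \<inter> {..task_fun t n}) \<le> n"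
    and x_gamma: "\<And>t. omega_on (stage_set x (underS r t)) (task_open t) \<Longrightarrow>
      \<exists>g. \<forall>y. y \<in> stage_set x (underS r t) \<or> y \<subseteq>\<^sup>* x t \<longrightarrow>
        (\<forall>\<^sub>F n in sequentially. y \<in> task_open t n (g n))"
    using ex_tower[OF p_eq_c] unfolding r_def by blast
  have "well_order_on UNIV r" unfolding r_def by (rule card_of_well_order_on)
  then have total: "s = t \<or> s \<in> underS r t \<or> t \<in> underS r s" for s t
    by (auto simp: well_order_on_def linear_order_on_def total_on_def underS_def)
  define X where "X = stage_set x UNIV"
  have X_iff: "y \<in> X \<longleftrightarrow> finite y \<or> (\<exists>t. y \<subseteq>\<^sup>* x t \<and> x t \<subseteq>\<^sup>* y)" for y
    by (auto simp: X_def stage_set_def Fin_def)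
  have X_cases: "y \<in> stage_set x (underS r t) \<or> y \<subseteq>\<^sup>* x t" if y: "y \<in> X" for y t
  proof (cases "finite y")
    case True
    then show ?thesis by (simp add: stage_set_def Fin_def)
  next
    case False
    then obtain u where u: "y \<subseteq>\<^sup>* x u" "x u \<subseteq>\<^sup>* y" using y by (auto simp: X_iff)
    consider "u = t" | "u \<in> underS r t" | "t \<in> underS r u" using total by blast
    then show ?thesis
    proof cases
      case 1 then show ?thesis using u by simp
    next
      case 2 then show ?thesis using u by (auto simp: stage_set_def)
    next
      case 3 then show ?thesis using u(1) x_dec almost_subset_trans by blast
    qed
  qed
  have "S1 Omega_covers Gamma_covers (subtopology cantor_space X)"
    unfolding S1_def
  proof (intro allI impI)
    fix \<U> :: "nat \<Rightarrow> nat set set set"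
    assume "\<forall>n. \<U> n \<in> Omega_covers (subtopology cantor_space X)"
    then have count: "countable (\<U> n)" and cover: "omega_cover (subtopology cantor_space X) (\<U> n)" for n
      by (simp_all add: Omega_covers_def)
    have fin: "\<exists>V\<in>\<U> n. F \<subseteq> V" if "finite F" "F \<subseteq> X" for n F
      using cover[of n] that by (simp add: omega_cover_def)
    have op: "openin (subtopology cantor_space X) V" if "V \<in> \<U> n" for n V
      using cover[of n] that unfolding omega_cover_def open_cover_def by (elim conjE bspec)
    have proper: "\<not> topspace (subtopology cantor_space X) \<subseteq> V" if "V \<in> \<U> n" for n V
      using cover[of n] that unfolding omega_cover_def by (elim conjE bspec)
    have ne: "\<U> n \<noteq> {}" for n using fin[of "{}" n] by blast
    define V where "V n = from_nat_into (\<U> n)" for n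
    have V_in: "V n m \<in> \<U> n" for n m using ne by (simp add: V_def from_nat_into)
    have "\<exists>O'. openin cantor_space O' \<and> V n m = O' \<inter> X" for n m
      using op[OF V_in] unfolding openin_subtopology .
    then obtain U where U: "\<And>n m. openin cantor_space (U n m)" "\<And>n m. V n m = U n m \<inter> X" by metis
    obtain t where t: "task_open t = U" using task_open_surj[of U] U(1) by blast
    have sub: "stage_set x (underS r t) \<subseteq> X" by (auto simp: X_def stage_set_def)
    have "omega_on (stage_set x (underS r t)) (task_open t)"
      unfolding omega_on_def
    proof (intro allI impI, elim conjE)
      fix n F assume F: "finite F" "F \<subseteq> stage_set x (underS r t)"
      then obtain W where W: "W \<in> \<U> n" "F \<subseteq> W" using fin sub by blast
      then obtain m where "W = V n m"
        using from_nat_into_surj[OF count] unfolding V_def by metis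
      then show "\<exists>m. F \<subseteq> task_open t n m" using W(2) U(2) t by auto
    qed
    from x_gamma[OF this] obtain g where g: "\<And>y. y \<in> X \<Longrightarrow> \<forall>\<^sub>F n in sequentially. y \<in> U n (g n)"
      using X_cases unfolding t by blast
    have "gamma_cover (subtopology cantor_space X) (range (\<lambda>n. V n (g n)))"
    proof (rule gamma_coverI_sequence)
      show "openin (subtopology cantor_space X) (V n (g n))" for n using op V_in .
      show "\<not> topspace (subtopology cantor_space X) \<subseteq> V n (g n)" for n using proper V_in .
    next
      fix y assume "y \<in> topspace (subtopology cantor_space X)"
      then have "y \<in> X" by simp
      then show "\<forall>\<^sub>F n in sequentially. y \<in> V n (g n)" using g by (simp add: U(2))
    qed
    then have "{V n (g n) | n. True} \<in> Gamma_covers (subtopology cantor_space X)"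
      by (simp add: Gamma_covers_def full_SetCompr_eq)
    then show "\<exists>U. (\<forall>n. U n \<in> \<U> n) \<and> {U n | n. True} \<in> Gamma_covers (subtopology cantor_space X)"
      using V_in by (intro exI[of _ "\<lambda>n. V n (g n)"]) simp
  qed
  moreover have "Fin \<subseteq> X" by (simp add: X_def stage_set_def)
  moreover have "y \<subseteq>\<^sup>* z \<or> z \<subseteq>\<^sup>* y" if yz: "y \<in> X - Fin" "z \<in> X - Fin" for y z
  proof -
    obtain s t where st: "y \<subseteq>\<^sup>* x s" "x s \<subseteq>\<^sup>* y" "z \<subseteq>\<^sup>* x t" "x t \<subseteq>\<^sup>* z"
      using yz by (auto simp: X_iff Fin_def)
    have "x s \<subseteq>\<^sup>* x t \<or> x t \<subseteq>\<^sup>* x s" using total[of s t] x_dec by auto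
    then show ?thesis using st almost_subset_trans by meson
  qed
  moreover have "z \<in> X" if "y \<in> X" "y \<subseteq>\<^sup>* z" "z \<subseteq>\<^sup>* y" for y z
    using that almost_subset_infinite[of z y] almost_subset_trans unfolding X_iff by meson
  moreover have "\<exists>y\<in>X - Fin. \<forall>n. card (y \<inter> {..f n}) \<le> n" for f
  proof -
    obtain t where "task_fun t = f" using task_fun_surj by blast
    moreover have "x t \<in> X - Fin" using x_inf by (auto simp: X_iff Fin_def intro!: exI[of _ t])
    ultimately show ?thesis using x_sparse by blast
  qed
  ultimately show ?thesis by blast
qed

section \<open>Removing the finite sets\<close>

lemma infinite_imp_card_Int_atMost_gt:
  fixes A :: "nat set"
  assumes "infinite A"
  shows "\<exists>M. \<forall>m\<ge>M. n < card (A \<inter> {..m})"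
proof -
  obtain B where B: "finite B" "card B = Suc n" "B \<subseteq> A"
    using infinite_arbitrarily_large[OF assms] by blast
  obtain M where M: "B \<subseteq> {..M}" using B(1) finite_nat_iff_bounded_le by blast
  have "n < card (A \<inter> {..m})" if "M \<le> m" for m
  proof -
    have "B \<subseteq> A \<inter> {..m}" using B M that by auto
    then have "card B \<le> card (A \<inter> {..m})" by (intro card_mono) auto
    then show ?thesis using B by simp
  qed
  then show ?thesis by blast
qed

text \<open>The \<open>n\<close>-th cover asks for more than \<open>n\<close> elements up to
  \<open>m\<close>. It increases with \<open>m\<close>, so a finite choice is bounded by one index
  \<open>f n\<close>; a set sparse for \<open>f\<close> escapes all the choices. The same bound
  excludes finite subcovers.\<close>

lemma not_Ufin_sparse:
  assumes inf: "\<And>x. x \<in> Z \<Longrightarrow> infinite x"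
    and sparse: "\<And>f :: nat \<Rightarrow> nat. \<exists>x\<in>Z. \<forall>n. card (x \<inter> {..f n}) \<le> n"
  shows "\<not> Ufin Gamma_covers O_covers (subtopology cantor_space Z)"
proof
  assume Ufin: "Ufin Gamma_covers O_covers (subtopology cantor_space Z)"
  define U where "U n m = {x\<in>Z. n < card (x \<inter> {..m})}" for n m :: nat
  have mono: "U n m \<subseteq> U n m'" if "m \<le> m'" for n m m'
  proof -
    have "card (x \<inter> {..m}) \<le> card (x \<inter> {..m'})" for x :: "nat set"
      using that by (intro card_mono) auto
    then show ?thesis by (auto simp: U_def intro: less_le_trans)
  qed
  have proper: "\<not> Z \<subseteq> U n m" for n m
    using sparse[of "\<lambda>_. m"] by (auto simp: U_def subset_iff not_less)
  have bound: "\<exists>M. \<Union>\<F> \<subseteq> U n M" if \<F>: "\<F> \<subseteq> range (U n)" "finite \<F>" for n \<F>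
  proof -
    obtain K where K: "finite K" "\<F> = U n ` K"
      using finite_subset_image[OF \<F>(2,1)] by blast
    then obtain M where "K \<subseteq> {..M}" using finite_nat_iff_bounded_le by blast
    then have "\<Union>\<F> \<subseteq> U n M" using K mono by blast
    then show ?thesis ..
  qed
  have "gamma_cover (subtopology cantor_space Z) (range (U n))" for n
  proof (rule gamma_coverI_sequence)
    show "openin (subtopology cantor_space Z) (U n m)" for m
      unfolding U_def
      by (rule clopen_cantor_space_finite_support(1)[where k = "Suc m"])
        (simp add: Int_assoc lessThan_Suc_atMost)
    show "\<not> topspace (subtopology cantor_space Z) \<subseteq> U n m" for m using proper by simp
  next
    fix x assume "x \<in> topspace (subtopology cantor_space Z)"
    then have "x \<in> Z" by simp
    then show "\<forall>\<^sub>F m in sequentially. x \<in> U n m"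
      using infinite_imp_card_Int_atMost_gt[OF inf, of x n]
      unfolding eventually_sequentially U_def by simp
  qed
  then have "range (U n) \<in> Gamma_covers (subtopology cantor_space Z)" for n
    by (simp add: Gamma_covers_def)
  moreover have "\<not> (\<F> \<subseteq> range (U n) \<and> finite \<F> \<and> \<Union>\<F> = topspace (subtopology cantor_space Z))" for n \<F>
    using bound[of \<F> n] proper[of n] by auto
  ultimately have "\<forall>n. range (U n) \<in> Gamma_covers (subtopology cantor_space Z) \<and>
      (\<nexists>\<F>. \<F> \<subseteq> range (U n) \<and> finite \<F> \<and> \<Union>\<F> = topspace (subtopology cantor_space Z))"
    by simp
  from mp[OF Ufin[unfolded Ufin_def, THEN spec, of "\<lambda>n. range (U n)"] this]
  obtain \<F> where \<F>: "\<And>n. \<F> n \<subseteq> range (U n)" "\<And>n. finite (\<F> n)"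
      "{\<Union>(\<F> n) | n. True} \<in> O_covers (subtopology cantor_space Z)"
    by blast
  obtain f where f: "\<And>n. \<Union>(\<F> n) \<subseteq> U n (f n)" using bound[OF \<F>(1,2)] by metis
  obtain x where x: "x \<in> Z" "\<And>n. card (x \<inter> {..f n}) \<le> n" using sparse[of f] by blast
  have "\<Union>{\<Union>(\<F> n) | n. True} = Z" using \<F>(3) by (simp add: O_covers_def open_cover_def)
  then obtain n where "x \<in> \<Union>(\<F> n)" using x(1) by blast
  then have "x \<in> U n (f n)" using f by blast
  then show False using x(2)[of n] by (simp add: U_def)
qed

text \<open>The injection \<open>U\<close> translates covers into sets of numbers: members
  containing \<open>x\<close> but not \<open>y\<close> correspond to \<open>x - y\<close>, and a
  \<gamma>-subcover to an infinite \<open>A\<close> with every \<open>A - x\<close> finite.\<close>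

lemma not_tau_set_sparse_chain:
  assumes inf: "\<And>x. x \<in> Z \<Longrightarrow> infinite x"
    and chain: "\<And>x y. x \<in> Z \<Longrightarrow> y \<in> Z \<Longrightarrow> x \<subseteq>\<^sup>* y \<or> y \<subseteq>\<^sup>* x"
    and modify: "\<And>x y. x \<in> Z \<Longrightarrow> x \<subseteq>\<^sup>* y \<Longrightarrow> y \<subseteq>\<^sup>* x \<Longrightarrow> y \<in> Z"
    and sparse: "\<And>f :: nat \<Rightarrow> nat. \<exists>x\<in>Z. \<forall>n. card (x \<inter> {..f n}) \<le> n"
  shows "\<not> tau_set (subtopology cantor_space Z)"
proof
  assume tau_set: "tau_set (subtopology cantor_space Z)"
  define U where "U n = {x\<in>Z. n \<in> x}" for n :: nat
  obtain z where z: "z \<in> Z" using sparse by blast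
  have modified: "y \<in> Z" if "y \<subseteq> insert n z" "z - {m} \<subseteq> y" for y n m
  proof (rule modify[OF z])
    have "z - y \<subseteq> {m}" "y - z \<subseteq> {n}" using that by auto
    then show "z \<subseteq>\<^sup>* y" "y \<subseteq>\<^sup>* z" unfolding almost_subset_def by (auto intro: finite_subset)
  qed
  have "inj U"
  proof (rule injI, rule ccontr)
    fix n m assume eq: "U n = U m" "n \<noteq> m"
    \<comment> \<open>This finite modification of \<open>z\<close> contains \<open>n\<close> but not
      \<open>m\<close>, and so separates \<open>U n\<close> from \<open>U m\<close>.\<close>
    have "insert n z - {m} \<in> U n" using modified[of "insert n z - {m}" n m] eq(2) by (auto simp: U_def)
    then have "insert n z - {m} \<in> U m" by (simp only: eq(1))
    then show False by (simp add: U_def)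
  qed
  have clopen: "openin (subtopology cantor_space Z) (U n)" "closedin (subtopology cantor_space Z) (U n)" for n
    unfolding U_def by (rule clopen_cantor_space_finite_support[where k = "Suc n"]; simp)+
  have proper: "\<not> Z \<subseteq> U n" for n using modified[of "z - {n}" n n] by (auto simp: U_def)
  have "tau_cover (subtopology cantor_space Z) (range U)"
    unfolding tau_cover_def open_cover_def
  proof (intro conjI ballI)
    have "x \<noteq> {}" if "x \<in> Z" for x using inf[OF that] by auto
    then show "\<Union>(range U) = topspace (subtopology cantor_space Z)" by (auto simp: U_def)
  next
    fix x assume "x \<in> topspace (subtopology cantor_space Z)"
    then have x: "x \<in> Z" by simp
    then have "{V \<in> range U. x \<in> V} = U ` x" by (auto simp: U_def)
    moreover have "infinite (U ` x)"
      using inf[OF x] \<open>inj U\<close> by (simp add: finite_image_iff inj_on_subset)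
    ultimately show "infinite {V \<in> range U. x \<in> V}" by simp
    fix y assume "y \<in> topspace (subtopology cantor_space Z)"
    then have y: "y \<in> Z" by simp
    have "{V \<in> range U. x \<in> V \<and> y \<notin> V} = U ` (x - y)" "{V \<in> range U. y \<in> V \<and> x \<notin> V} = U ` (y - x)"
      using x y by (auto simp: U_def)
    then show "finite {V \<in> range U. x \<in> V \<and> y \<notin> V} \<or> finite {V \<in> range U. y \<in> V \<and> x \<notin> V}"
      using chain[OF x y] by (auto simp: almost_subset_def)
  qed (use clopen proper in auto)
  moreover have "\<forall>V\<in>range U. closedin (subtopology cantor_space Z) V" using clopen by blast
  ultimately obtain \<V> where \<V>: "\<V> \<subseteq> range U" "gamma_cover (subtopology cantor_space Z) \<V>"
    using tau_set unfolding tau_set_def by blast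
  define A where "A = {n. U n \<in> \<V>}"
  have "\<V> = U ` A" using \<V>(1) by (auto simp: A_def)
  then have "infinite A" using \<V>(2) by (auto simp: gamma_cover_def)
  \<comment> \<open>The factor 2 accounts for the two parts of \<open>A\<close> up to
    \<open>f k\<close>: at most \<open>k\<close> elements in \<open>x\<close> by sparseness, and at
    most \<open>k = card (A - x)\<close> outside \<open>x\<close>.\<close>
  then have "\<forall>n. \<exists>m. 2 * n < card (A \<inter> {..m})"
    using infinite_imp_card_Int_atMost_gt by blast
  then obtain f where f: "\<And>n. 2 * n < card (A \<inter> {..f n})" by metis
  obtain x where x: "x \<in> Z" "\<And>n. card (x \<inter> {..f n}) \<le> n" using sparse[of f] by blast
  have "U ` (A - x) \<subseteq> {V\<in>\<V>. x \<notin> V}" by (auto simp: A_def U_def)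
  moreover have "finite {V\<in>\<V>. x \<notin> V}" using \<V>(2) x(1) by (simp add: gamma_cover_def)
  ultimately have "finite (U ` (A - x))" by (rule finite_subset)
  then have fin: "finite (A - x)" using \<open>inj U\<close> by (simp add: finite_image_iff inj_on_subset)
  define k where "k = card (A - x)"
  have "A \<inter> {..f k} \<subseteq> (x \<inter> {..f k}) \<union> (A - x)" by auto
  then have "card (A \<inter> {..f k}) \<le> card ((x \<inter> {..f k}) \<union> (A - x))"
    using fin by (intro card_mono) auto
  also have "\<dots> \<le> card (x \<inter> {..f k}) + card (A - x)" by (rule card_Un_le)
  also have "\<dots> \<le> 2 * k" using x(2)[of k] by (simp add: k_def)
  finally show False using f[of k] by simp
qed

theorem theorem3p1:
  assumes "pseudointersection_number =o continuum"
  shows "\<exists>X :: nat set set.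
           S1 Omega_covers Gamma_covers (subtopology cantor_space X) \<and>
           \<not> Ufin Gamma_covers O_covers (subtopology cantor_space (X - Fin)) \<and>
           tau_set (subtopology cantor_space X) \<and>
           \<not> tau_set (subtopology cantor_space (X - Fin))"
proof -
  obtain X where S1: "S1 Omega_covers Gamma_covers (subtopology cantor_space X)" and Fin: "Fin \<subseteq> X"
    and chain: "\<And>x y. x \<in> X - Fin \<Longrightarrow> y \<in> X - Fin \<Longrightarrow> x \<subseteq>\<^sup>* y \<or> y \<subseteq>\<^sup>* x"
    and modify: "\<And>x y. x \<in> X \<Longrightarrow> x \<subseteq>\<^sup>* y \<Longrightarrow> y \<subseteq>\<^sup>* x \<Longrightarrow> y \<in> X"
    and sparse: "\<And>f. \<exists>x\<in>X - Fin. \<forall>n. card (x \<inter> {..f n}) \<le> n"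
    using ex_S1_tower_set[OF assms] by auto
  have inf: "infinite x" if "x \<in> X - Fin" for x using that by (simp add: Fin_def)
  have modify': "y \<in> X - Fin" if "x \<in> X - Fin" "x \<subseteq>\<^sup>* y" "y \<subseteq>\<^sup>* x" for x y
    using that modify[of x y] almost_subset_infinite[of x y] by (simp add: Fin_def)
  have "{} \<in> X" using Fin by (auto simp: Fin_def)
  then have "tau_set (subtopology cantor_space X)"
    using S1_Omega_Gamma_imp_tau_set[OF S1] by blast
  moreover have "\<not> Ufin Gamma_covers O_covers (subtopology cantor_space (X - Fin))"
    using inf sparse by (rule not_Ufin_sparse)
  moreover have "\<not> tau_set (subtopology cantor_space (X - Fin))"
    using inf chain modify' sparse by (rule not_tau_set_sparse_chain)
  ultimately show ?thesis using S1 by blast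
qed

end
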